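(* Let $\mathcal{J}$ be a kernel in an operator system. Then $\delta(\mathcal{J})\le\vartheta(\mathcal{J})$ and $\delta_{cb}(\mathcal{J})\le\vartheta_{cb}(\mathcal{J})$.
   Context: An operator system is a unital $*$-closed subspace $\mathcal{S}$ of some $\mathcal{B}(\mathcal{H})$, with $M_n(\mathcal{S})^+ = M_n(\mathcal{S})\cap \mathcal{B}(\mathcal{H}\otimes\mathbb{C}^n)^+$ and norms on $M_n(\mathcal S)$ inherited from $\mathcal{B}(\mathcal{H}\otimes\mathbb{C}^n)$. A subspace $\mathcal{J}\subseteq\mathcal{S}$ is a kernel if $\mathcal{J}=\ker\phi$ for some unital completely positive map $\phi:\mathcal{S}\to\mathcal{T}$ into an operator system $\mathcal{T}$. A complete order isomorphism is a linear bijection that is completely positive with completely positive inverse. Write $1_n$ for the diagonal matrix in $M_n(\mathcal{S})$ with all diagonal entries $1$, and, for $X=(x_{i,j})\in M_n(\mathcal{S})$, $\dot X=(x_{i,j}+\mathcal{J})\in M_n(\mathcal{S}/\mathcal{J})$. Quotient operator system: let $\mathcal{D}_n(\mathcal{S}/\mathcal{J})$ be the set of $\dot X$ for which there is $Y\in M_n(\mathcal{J})$ with $X+Y\in M_n(\mathcal{S})^+$; and $\dot X\in M_n(\mathcal{S}/\mathcal{J})^+$ iff $\dot X+\epsilon\dot 1_n\in\mathcal{D}_n(\mathcal{S}/\mathcal{J})$ for all $\epsilon>0$. This makes $\mathcal{S}/\mathcal{J}$ an operator system. Its norm (operator system quotient norm) is $$\|\dot X\|_{\mathrm{osy}}=\inf\Big\{\lambda\ge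 0:\begin{pmatrix}\lambda\dot 1_n&\dot X\\ \dot X^*&\lambda\dot 1_n\end{pmatrix}\in M_{2n}(\mathcal{S}/\mathcal{J})^+\Big\}.$$ The operator space quotient norm is $\|\dot X\|_{\mathrm{osp}}=\inf\{\|X+Y\|: Y\in M_n(\mathcal{J})\}$. Relative $n$-distortion: $\delta_n(\mathcal{S},\mathcal{J})=\sup\{\|\dot X\|_{\mathrm{osp}}/\|\dot X\|_{\mathrm{osy}} : X\in M_n(\mathcal{S}),\ \dot X\neq 0\}$. A kernel $\mathcal{J}$ in $\mathcal{S}$ is identified with a kernel $\mathcal{K}$ in $\mathcal{T}$ whenever the operator systems $\mathbb{C}1+\mathcal{J}$ and $\mathbb{C}1+\mathcal{K}$ are unitally completely order isomorphic. Absolute $n$-distortion: $\delta_n(\mathcal{J})=\sup_{\mathcal{S}}\delta_n(\mathcal{S},\mathcal{J})$, the supremum being over all operator systems $\mathcal{S}$ that contain $\mathcal{J}$ as a kernel. Set $\delta(\mathcal{J})=\delta_1(\mathcal{J})$ and $\delta_{cb}(\mathcal{J})=\sup_n\delta_n(\mathcal{J})$. Theta parameters: $\vartheta_n(\mathcal{J})=\sup\{\|1_n+J\|_{M_n(\mathcal{S})}: J\in M_n(\mathcal{J}),\ 1_n+J\ge 0\}$, $\vartheta(\mathcal{J})=\vartheta_1(\mathcal{J})$, $\vartheta_{cb}(\mathcal{J})=\sup_n\vartheta_n(\mathcal{J})$. All these quantities may take the value $+\infty$.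
   Formalization: Kernels J and K are identified only when a unital complete order isomorphism of C1+J onto C1+K carries J onto K; with isomorphism of C1+J and C1+K alone the claim fails, e.g. for the span of (1,-1) in C+C, where theta is 2 but the distortion would be infinite. *)

theory Defs
  imports
    "HOL-Analysis.Bounded_Linear_Function"
    "HOL-Analysis.L2_Norm"
    "HOL-Library.Extended_Nonnegative_Real"
    "HOL-Library.Nonpos_Ints"
    "Jordan_Normal_Form.Matrix"
begin

section \<open>Complex Hilbert spaces\<close>

class complex_vector = real_vector +
  fixes scaleC :: "complex \<Rightarrow> 'a \<Rightarrow> 'a"  (infixr \<open>*\<^sub>C\<close> 75)
  assumes scaleC_add_right: "a *\<^sub>C (x + y) = a *\<^sub>C x + a *\<^sub>C y"
    and scaleC_add_left: "(a + b) *\<^sub>C x = a *\<^sub>C x + b *\<^sub>C x"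
    and scaleC_scaleC: "a *\<^sub>C (b *\<^sub>C x) = (a * b) *\<^sub>C x"
    and scaleR_scaleC: "r *\<^sub>R x = complex_of_real r *\<^sub>C x"

text \<open>The complex inner product is linear in the second argument. Its real part is the library's
  real inner product, so norm, topology and completeness are those of the library classes.\<close>

class complex_hilbert_space = complex_vector + real_inner + complete_space +
  fixes cinner :: "'a \<Rightarrow> 'a \<Rightarrow> complex"
  assumes cinner_commute: "cinner x y = cnj (cinner y x)"
    and cinner_add_right: "cinner x (y + z) = cinner x y + cinner x z"
    and cinner_scaleC_right: "cinner x (a *\<^sub>C y) = a * cinner x y"
    and inner_eq_Re_cinner: "inner x y = Re (cinner x y)"

global_interpretation complex_vector:
  vector_space "scaleC :: complex \<Rightarrow> 'a \<Rightarrow> 'a::complex_vector"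
proof
  show "1 *\<^sub>C x = x" for x :: 'a
    using scaleR_scaleC[of 1 x] by simp
qed (simp_all add: scaleC_add_right scaleC_add_left scaleC_scaleC)

instantiation complex :: complex_hilbert_space
begin
definition "scaleC_complex a (x::complex) = a * x"
definition "cinner_complex (x::complex) y = cnj x * y"
instance
  by standard
    (simp_all add: scaleC_complex_def cinner_complex_def algebra_simps inner_complex_def
      scaleR_conv_of_real)
end

lemma cinner_add_left:
  "cinner (x + y) z = cinner x z + cinner (y :: 'a::complex_hilbert_space) z"
  by (metis cinner_add_right cinner_commute complex_cnj_add)

lemma cinner_scaleC_left:
  "cinner (a *\<^sub>C x) y = cnj a * cinner x (y :: 'a::complex_hilbert_space)"
  by (metis cinner_commute cinner_scaleC_right complex_cnj_mult)

lemma cinner_self: "cinner x x = complex_of_real ((norm (x :: 'a::complex_hilbert_space))\<^sup>2)"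
proof -
  have "Im (cinner x x) = 0"
    using arg_cong[OF cinner_commute[of x x], of Im] by simp
  moreover have "Re (cinner x x) = (norm x)\<^sup>2"
    by (metis inner_eq_Re_cinner power2_norm_eq_inner)
  ultimately show ?thesis
    by (simp add: complex_eq_iff)
qed

lemma norm_scaleC: "norm (a *\<^sub>C x) = cmod a * norm (x :: 'a::complex_hilbert_space)"
proof -
  have "complex_of_real ((norm (a *\<^sub>C x))\<^sup>2) = (cnj a * a) * cinner x x"
    by (simp only: cinner_self[symmetric] cinner_scaleC_left cinner_scaleC_right mult.assoc mult.left_commute)
  also have "\<dots> = complex_of_real ((cmod a * norm x)\<^sup>2)"
    using complex_norm_square[of a]
    by (simp add: cinner_self power_mult_distrib mult.commute)
  finally have "(norm (a *\<^sub>C x))\<^sup>2 = (cmod a * norm x)\<^sup>2"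
    by (simp only: of_real_eq_iff)
  then show ?thesis
    by simp
qed

lemma bounded_linear_scaleC: "bounded_linear (\<lambda>x :: 'a::complex_hilbert_space. a *\<^sub>C x)"
  by (rule bounded_linear_intro[where K = "cmod a"])
    (simp_all add: scaleC_add_right scaleR_scaleC scaleC_scaleC norm_scaleC mult.commute)


section \<open>Operators\<close>

text \<open>An element of \<open>'a \<Rightarrow>\<^sub>L 'a\<close> is a bounded real-linear operator; membership in \<open>B(H)\<close>
  additionally requires \<open>clinear_op\<close>.\<close>

instantiation blinfun :: (complex_hilbert_space, complex_hilbert_space) complex_vector
begin
lift_definition scaleC_blinfun :: "complex \<Rightarrow> ('a \<Rightarrow>\<^sub>L 'b) \<Rightarrow> ('a \<Rightarrow>\<^sub>L 'b)"
  is "\<lambda>c f x. c *\<^sub>C f x"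
  by (rule bounded_linear_compose[OF bounded_linear_scaleC])
instance
  by standard (transfer; simp add: fun_eq_iff scaleC_add_right scaleC_add_left scaleC_scaleC scaleR_scaleC)+
end

definition clinear_op :: "('a::complex_hilbert_space \<Rightarrow>\<^sub>L 'a) \<Rightarrow> bool" where
  "clinear_op T \<longleftrightarrow> (\<forall>c x. blinfun_apply T (c *\<^sub>C x) = c *\<^sub>C blinfun_apply T x)"

definition is_cadjoint ::
  "('a::complex_hilbert_space \<Rightarrow>\<^sub>L 'a) \<Rightarrow> ('a \<Rightarrow>\<^sub>L 'a) \<Rightarrow> bool" where
  "is_cadjoint T U \<longleftrightarrow> (\<forall>x y. cinner (blinfun_apply T x) y = cinner x (blinfun_apply U y))"

text \<open>Only used for elements of operator systems, which have an adjoint by definition.\<close>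

definition cadjoint :: "('a::complex_hilbert_space \<Rightarrow>\<^sub>L 'a) \<Rightarrow> ('a \<Rightarrow>\<^sub>L 'a)" where
  "cadjoint T = (THE U. is_cadjoint T U)"

lemma is_cadjoint_unique:
  assumes "is_cadjoint T U" "is_cadjoint T V"
  shows "U = V"
proof (rule blinfun_eqI)
  fix y
  have *: "cinner x (blinfun_apply U y) = cinner x (blinfun_apply V y)" for x
    using assms unfolding is_cadjoint_def by metis
  have "inner x (blinfun_apply U y) = inner x (blinfun_apply V y)" for x
    by (simp add: inner_eq_Re_cinner *)
  then have "inner (blinfun_apply U y - blinfun_apply V y) (blinfun_apply U y - blinfun_apply V y) = 0"
    by (simp add: inner_diff_right)
  then show "blinfun_apply U y = blinfun_apply V y"
    by simp
qed

lemma cadjoint_eqI: "is_cadjoint T U \<Longrightarrow> cadjoint T = U"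
  unfolding cadjoint_def by (blast intro: is_cadjoint_unique)


section \<open>Matrices of operators, acting on \<open>H \<otimes> \<complex>\<^sup>n = H\<^sup>n\<close>\<close>

text \<open>A vector of \<open>H\<^sup>n\<close> is a function \<open>\<xi> :: nat \<Rightarrow> 'a\<close> of which only the values at \<open>i < n\<close> matter.\<close>

definition mat_apply ::
  "('a::complex_hilbert_space \<Rightarrow>\<^sub>L 'a) mat \<Rightarrow> (nat \<Rightarrow> 'a) \<Rightarrow> nat \<Rightarrow> 'a" where
  "mat_apply A \<xi> i = (\<Sum>j<dim_col A. blinfun_apply (A $$ (i, j)) (\<xi> j))"

definition mat_pos :: "('a::complex_hilbert_space \<Rightarrow>\<^sub>L 'a) mat \<Rightarrow> bool" where
  "mat_pos A \<longleftrightarrow> (\<forall>\<xi>. (\<Sum>i<dim_row A. cinner (\<xi> i) (mat_apply A \<xi> i)) \<in> \<real>\<^sub>\<ge>\<^sub>0)"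

definition mat_norm :: "('a::complex_hilbert_space \<Rightarrow>\<^sub>L 'a) mat \<Rightarrow> real" where
  "mat_norm A = (SUP \<xi>. L2_set (\<lambda>i. norm (mat_apply A \<xi> i)) {..<dim_row A}
                       / L2_set (\<lambda>j. norm (\<xi> j)) {..<dim_col A})"

lemma bdd_above_mat_norm:
  fixes A :: "('a::complex_hilbert_space \<Rightarrow>\<^sub>L 'a) mat"
  shows "bdd_above (range (\<lambda>\<xi>. L2_set (\<lambda>i. norm (mat_apply A \<xi> i)) {..<dim_row A}
                       / L2_set (\<lambda>j. norm (\<xi> j)) {..<dim_col A}))"
proof (rule bdd_aboveI2)
  fix \<xi> :: "nat \<Rightarrow> 'a"
  let ?C = "\<Sum>i<dim_row A. \<Sum>j<dim_col A. norm (A $$ (i, j))"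
  let ?x = "L2_set (\<lambda>j. norm (\<xi> j)) {..<dim_col A}"
  have C: "0 \<le> ?C"
    by (intro sum_nonneg) auto
  have "norm (mat_apply A \<xi> i) \<le> (\<Sum>j<dim_col A. norm (A $$ (i, j)) * ?x)" for i
    unfolding mat_apply_def
    by (intro order.trans[OF norm_sum] sum_mono order.trans[OF norm_blinfun] mult_left_mono
        member_le_L2_set) auto
  then have "(\<Sum>i<dim_row A. norm (mat_apply A \<xi> i))
      \<le> (\<Sum>i<dim_row A. \<Sum>j<dim_col A. norm (A $$ (i, j)) * ?x)"
    by (intro sum_mono)
  moreover have "L2_set (\<lambda>i. norm (mat_apply A \<xi> i)) {..<dim_row A}
      \<le> (\<Sum>i<dim_row A. norm (mat_apply A \<xi> i))"
    by (intro L2_set_le_sum) auto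
  ultimately have "L2_set (\<lambda>i. norm (mat_apply A \<xi> i)) {..<dim_row A} \<le> ?C * ?x"
    by (simp add: sum_distrib_right)
  then show "L2_set (\<lambda>i. norm (mat_apply A \<xi> i)) {..<dim_row A} / ?x \<le> ?C"
    using C L2_set_nonneg[of "\<lambda>j. norm (\<xi> j)" "{..<dim_col A}"]
    by (cases "?x = 0") (simp, metis order_le_less pos_divide_le_eq)
qed

definition one_op_mat :: "nat \<Rightarrow> ('a::complex_hilbert_space \<Rightarrow>\<^sub>L 'a) mat" where
  "one_op_mat n = mat n n (\<lambda>(i, j). if i = j then id_blinfun else 0)"

definition scaleR_mat :: "real \<Rightarrow> 'a::real_vector mat \<Rightarrow> 'a mat" where
  "scaleR_mat r A = map_mat (scaleR r) A"

definition cadjoint_mat ::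
  "('a::complex_hilbert_space \<Rightarrow>\<^sub>L 'a) mat \<Rightarrow> ('a \<Rightarrow>\<^sub>L 'a) mat" where
  "cadjoint_mat A = map_mat cadjoint (transpose_mat A)"


section \<open>Operator systems and kernels\<close>

definition operator_system :: "('a::complex_hilbert_space \<Rightarrow>\<^sub>L 'a) set \<Rightarrow> bool" where
  "operator_system S \<longleftrightarrow>
     complex_vector.subspace S \<and>
     (\<forall>T\<in>S. clinear_op T) \<and>
     id_blinfun \<in> S \<and>
     (\<forall>T\<in>S. \<exists>U\<in>S. is_cadjoint T U)"

definition mats :: "nat \<Rightarrow> 'a set \<Rightarrow> 'a mat set" where
  "mats n S = {A \<in> carrier_mat n n. elements_mat A \<subseteq> S}"

definition mats_pos ::
  "nat \<Rightarrow> ('a::complex_hilbert_space \<Rightarrow>\<^sub>L 'a) set \<Rightarrow> ('a \<Rightarrow>\<^sub>L 'a) mat set" where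
  "mats_pos n S = {A \<in> mats n S. mat_pos A}"

definition completely_positive ::
  "('a::complex_hilbert_space \<Rightarrow>\<^sub>L 'a) set \<Rightarrow> ('b::complex_hilbert_space \<Rightarrow>\<^sub>L 'b) set
    \<Rightarrow> (('a \<Rightarrow>\<^sub>L 'a) \<Rightarrow> ('b \<Rightarrow>\<^sub>L 'b)) \<Rightarrow> bool" where
  "completely_positive S T \<phi> \<longleftrightarrow>
     \<phi> ` S \<subseteq> T \<and>
     (\<forall>x\<in>S. \<forall>y\<in>S. \<phi> (x + y) = \<phi> x + \<phi> y) \<and>
     (\<forall>c. \<forall>x\<in>S. \<phi> (c *\<^sub>C x) = c *\<^sub>C \<phi> x) \<and>
     (\<forall>n. \<forall>X\<in>mats_pos n S. map_mat \<phi> X \<in> mats_pos n T)"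

definition complete_order_iso ::
  "('a::complex_hilbert_space \<Rightarrow>\<^sub>L 'a) set \<Rightarrow> ('b::complex_hilbert_space \<Rightarrow>\<^sub>L 'b) set
    \<Rightarrow> (('a \<Rightarrow>\<^sub>L 'a) \<Rightarrow> ('b \<Rightarrow>\<^sub>L 'b)) \<Rightarrow> bool" where
  "complete_order_iso S T \<phi> \<longleftrightarrow>
     bij_betw \<phi> S T \<and> completely_positive S T \<phi> \<and> completely_positive T S (inv_into S \<phi>)"

text \<open>The range of the map is an operator system on the Hilbert space \<open>'c\<close>. Since HOL cannot
  quantify over types inside a formula, \<open>'c\<close> is a parameter: \<open>J\<close> is a kernel in \<open>S\<close> iff
  \<open>is_kernel TYPE('c) S J\<close> holds for some type \<open>'c\<close>.\<close>

definition is_kernel ::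
  "'c::complex_hilbert_space itself \<Rightarrow> ('a::complex_hilbert_space \<Rightarrow>\<^sub>L 'a) set \<Rightarrow> ('a \<Rightarrow>\<^sub>L 'a) set \<Rightarrow> bool" where
  "is_kernel (_ :: 'c itself) S J \<longleftrightarrow>
     operator_system S \<and>
     (\<exists>(T :: ('c \<Rightarrow>\<^sub>L 'c) set) \<phi>.
        operator_system T \<and> completely_positive S T \<phi> \<and> \<phi> id_blinfun = id_blinfun \<and>
        J = {x \<in> S. \<phi> x = 0})"


section \<open>Quotient operator system and quotient norms\<close>

definition coset :: "'a::plus set \<Rightarrow> 'a \<Rightarrow> 'a set" where
  "coset J x = {x + y |y. y \<in> J}"

definition dot :: "'a::plus set \<Rightarrow> 'a mat \<Rightarrow> 'a set mat" where
  "dot J X = map_mat (coset J) X"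

definition quot_D ::
  "nat \<Rightarrow> ('a::complex_hilbert_space \<Rightarrow>\<^sub>L 'a) set \<Rightarrow> ('a \<Rightarrow>\<^sub>L 'a) set \<Rightarrow> ('a \<Rightarrow>\<^sub>L 'a) set mat set" where
  "quot_D n S J = {dot J X |X. X \<in> mats n S \<and> (\<exists>Y\<in>mats n J. X + Y \<in> mats_pos n S)}"

definition quot_pos ::
  "nat \<Rightarrow> ('a::complex_hilbert_space \<Rightarrow>\<^sub>L 'a) set \<Rightarrow> ('a \<Rightarrow>\<^sub>L 'a) set \<Rightarrow> ('a \<Rightarrow>\<^sub>L 'a) set mat set" where
  "quot_pos n S J = {dot J X |X. X \<in> mats n S \<and>
     (\<forall>\<epsilon>>0. dot J (X + scaleR_mat \<epsilon> (one_op_mat n)) \<in> quot_D n S J)}"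

text \<open>Both norms depend on the representative \<open>X\<close> only through \<open>dot J X\<close>.\<close>

definition osy_norm ::
  "nat \<Rightarrow> ('a::complex_hilbert_space \<Rightarrow>\<^sub>L 'a) set \<Rightarrow> ('a \<Rightarrow>\<^sub>L 'a) set \<Rightarrow> ('a \<Rightarrow>\<^sub>L 'a) mat \<Rightarrow> real" where
  "osy_norm n S J X = Inf {r. 0 \<le> r \<and>
     dot J (four_block_mat (scaleR_mat r (one_op_mat n)) X
                           (cadjoint_mat X) (scaleR_mat r (one_op_mat n))) \<in> quot_pos (2 * n) S J}"

definition osp_norm ::
  "nat \<Rightarrow> ('a::complex_hilbert_space \<Rightarrow>\<^sub>L 'a) set \<Rightarrow> ('a \<Rightarrow>\<^sub>L 'a) mat \<Rightarrow> real" where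
  "osp_norm n J X = Inf {mat_norm (X + Y) |Y. Y \<in> mats n J}"


section \<open>Distortion and theta parameters\<close>

definition rel_distortion ::
  "nat \<Rightarrow> ('a::complex_hilbert_space \<Rightarrow>\<^sub>L 'a) set \<Rightarrow> ('a \<Rightarrow>\<^sub>L 'a) set \<Rightarrow> ennreal" where
  "rel_distortion n S J = (SUP X \<in> {X \<in> mats n S. dot J X \<noteq> dot J (0\<^sub>m n n)}.
     ennreal (osp_norm n J X) / ennreal (osy_norm n S J X))"

definition unitization :: "('a::complex_hilbert_space \<Rightarrow>\<^sub>L 'a) set \<Rightarrow> ('a \<Rightarrow>\<^sub>L 'a) set" where
  "unitization J = {c *\<^sub>C id_blinfun + y |c y. y \<in> J}"

text \<open>The isomorphism has to carry one kernel onto the other: isomorphism of the unitizations alone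
  does not determine the kernel inside its unitization.\<close>

definition kernels_identified ::
  "('a::complex_hilbert_space \<Rightarrow>\<^sub>L 'a) set \<Rightarrow> ('b::complex_hilbert_space \<Rightarrow>\<^sub>L 'b) set \<Rightarrow> bool" where
  "kernels_identified J K \<longleftrightarrow>
     (\<exists>\<phi>. complete_order_iso (unitization J) (unitization K) \<phi> \<and>
          \<phi> id_blinfun = id_blinfun \<and> \<phi> ` J = K)"

text \<open>The supremum over all operator systems \<open>T\<close> containing (a copy \<open>K\<close> of) \<open>J\<close> as a kernel, where
  \<open>T\<close> acts on the Hilbert space \<open>'b\<close> and \<open>K\<close> is the kernel of a map into an operator system on \<open>'d\<close>.
  The absolute distortion is the supremum of these values over all types \<open>'b\<close> and \<open>'d\<close>; it is at most
  \<open>c\<close> iff \<open>distortion TYPE('b) TYPE('d) n J \<le> c\<close> holds for arbitrary \<open>'b\<close> and \<open>'d\<close>.\<close>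

definition distortion ::
  "'b::complex_hilbert_space itself \<Rightarrow> 'd::complex_hilbert_space itself \<Rightarrow> nat
    \<Rightarrow> ('a::complex_hilbert_space \<Rightarrow>\<^sub>L 'a) set \<Rightarrow> ennreal" where
  "distortion (_ :: 'b itself) (_ :: 'd itself) n J =
     (SUP (T, K) \<in> {(T :: ('b \<Rightarrow>\<^sub>L 'b) set, K). is_kernel TYPE('d) T K \<and> kernels_identified J K}.
        rel_distortion n T K)"

definition distortion_cb ::
  "'b::complex_hilbert_space itself \<Rightarrow> 'd::complex_hilbert_space itself
    \<Rightarrow> ('a::complex_hilbert_space \<Rightarrow>\<^sub>L 'a) set \<Rightarrow> ennreal" where
  "distortion_cb B D J = (SUP n\<in>{1..}. distortion B D n J)"

definition theta :: "nat \<Rightarrow> ('a::complex_hilbert_space \<Rightarrow>\<^sub>L 'a) set \<Rightarrow> ennreal" where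
  "theta n J = (SUP Y \<in> {Y \<in> mats n J. mat_pos (one_op_mat n + Y)}.
     ennreal (mat_norm (one_op_mat n + Y)))"

definition theta_cb :: "('a::complex_hilbert_space \<Rightarrow>\<^sub>L 'a) set \<Rightarrow> ennreal" where
  "theta_cb J = (SUP n\<in>{1..}. theta n J)"

end

theory Submission
  imports Defs
begin

text \<open>Both inequalities come from one bound at each matrix level \<open>n\<close> (lemma \<open>distortion_le_theta\<close>); the
  completely bounded one is its supremum over \<open>n\<close>.

  Let \<open>K\<close> be a kernel in \<open>S\<close> and let \<open>r\<close> exceed the system norm of the class of \<open>X\<close>.  Unfolding the
  order on the quotient, the matrix with diagonal blocks \<open>r1\<close> and off-diagonal blocks \<open>X\<close>, \<open>X\<^sup>*\<close> becomes
  positive after adding a matrix over \<open>K\<close> with blocks \<open>A\<close>, \<open>B\<close>, \<open>C\<close>, \<open>D\<close>.  The corners \<open>r1 + A\<close> and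
  \<open>r1 + D\<close> are then positive, and after division by \<open>r\<close> they are of the form that the theta parameter
  measures, so both are at most \<open>r\<vartheta>1\<close>.  An off-diagonal block of a positive matrix is controlled by its
  corners, whence \<open>\<parallel>X + B\<parallel> \<le> r\<vartheta>\<close>.  As \<open>B\<close> has its entries in \<open>K\<close>, the space norm of the class is
  at most \<open>r\<vartheta>\<close>; now let \<open>r\<close> decrease to the system norm.

  Only upper bounds \<open>1 + Y \<le> r1\<close> enter, and such order relations pass through a unital complete order
  isomorphism of the unitizations; this is why \<open>\<vartheta>\<close> may be computed in \<open>J\<close> although the quotient is taken
  by a copy \<open>K\<close> of \<open>J\<close>.  The three steps are \<open>mat_norm_off_diagonal_le\<close>, \<open>identified_kernel_form_le\<close> and
  \<open>osp_norm_le_theta\<close>.\<close>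

section \<open>Sesquilinear forms of operator matrices\<close>

abbreviation hnorm :: "nat \<Rightarrow> (nat \<Rightarrow> 'a::complex_hilbert_space) \<Rightarrow> real" where
  "hnorm n \<xi> \<equiv> L2_set (\<lambda>i. norm (\<xi> i)) {..<n}"

definition mat_form ::
  "('a::complex_hilbert_space \<Rightarrow>\<^sub>L 'a) mat \<Rightarrow> (nat \<Rightarrow> 'a) \<Rightarrow> (nat \<Rightarrow> 'a) \<Rightarrow> complex" where
  "mat_form A \<xi> \<eta> = (\<Sum>i<dim_row A. cinner (\<xi> i) (mat_apply A \<eta> i))"

lemma mat_pos_iff_form: "mat_pos A \<longleftrightarrow> (\<forall>\<xi>. 0 \<le> Re (mat_form A \<xi> \<xi>) \<and> Im (mat_form A \<xi> \<xi>) = 0)"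
proof -
  have "z \<in> \<real>\<^sub>\<ge>\<^sub>0 \<longleftrightarrow> 0 \<le> Re z \<and> Im z = 0" for z :: complex
    by (metis Re_complex_of_real Im_complex_of_real complex_is_Real_iff nonneg_Reals_cases
        nonneg_Reals_of_real_iff of_real_Re)
  then show ?thesis
    by (simp add: mat_pos_def mat_form_def)
qed

lemma cinner_zero_right: "cinner x 0 = (0 :: complex)"
  using cinner_scaleC_right[of x 0 0] by simp

lemma cinner_sum_right: "cinner x (\<Sum>j\<in>I. f j) = (\<Sum>j\<in>I. cinner x (f j))"
  by (induction I rule: infinite_finite_induct) (simp_all add: cinner_zero_right cinner_add_right)

lemma mat_form_sum:
  assumes "A \<in> carrier_mat n m"
  shows "mat_form A \<xi> \<eta> = (\<Sum>i<n. \<Sum>j<m. cinner (\<xi> i) (blinfun_apply (A $$ (i, j)) (\<eta> j)))"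
  using assms by (simp add: mat_form_def mat_apply_def cinner_sum_right)

lemma hnorm_squared: "(hnorm n \<xi>)\<^sup>2 = (\<Sum>i<n. (norm (\<xi> i))\<^sup>2)"
  by (simp add: L2_set_def sum_nonneg)

lemma cinner_scaleR_right: "cinner x (r *\<^sub>R y) = of_real r * cinner x y"
  by (simp add: scaleR_scaleC cinner_scaleC_right)

lemma cinner_scaleR_left: "cinner (r *\<^sub>R x) y = of_real r * cinner x y"
  by (simp add: scaleR_scaleC cinner_scaleC_left)

lemma cinner_diff_right: "cinner x (y - z) = cinner x y - cinner x z"
  by (metis add_diff_cancel_right' cinner_add_right diff_add_cancel)

lemma mat_form_diff:
  assumes "A \<in> carrier_mat n m" "B \<in> carrier_mat n m"
  shows "mat_form (A - B) \<xi> \<eta> = mat_form A \<xi> \<eta> - mat_form B \<xi> \<eta>"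
proof -
  have "A - B \<in> carrier_mat n m"
    using assms by auto
  then show ?thesis
    using assms by (simp add: mat_form_sum[where n = n and m = m] blinfun.diff_left cinner_diff_right
        sum_subtractf)
qed

lemma mat_form_add:
  assumes "A \<in> carrier_mat n m" "B \<in> carrier_mat n m"
  shows "mat_form (A + B) \<xi> \<eta> = mat_form A \<xi> \<eta> + mat_form B \<xi> \<eta>"
proof -
  have "A + B \<in> carrier_mat n m"
    using assms by auto
  then show ?thesis
    using assms by (simp add: mat_form_sum[where n = n and m = m] blinfun.add_left cinner_add_right
        sum.distrib)
qed

lemma scaleR_mat_carrier [simp]: "scaleR_mat r A \<in> carrier_mat n m \<longleftrightarrow> A \<in> carrier_mat n m"
  by (simp add: scaleR_mat_def)

lemma scaleR_mat_index [simp]: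
  "i < dim_row A \<Longrightarrow> j < dim_col A \<Longrightarrow> scaleR_mat r A $$ (i, j) = r *\<^sub>R A $$ (i, j)"
  "dim_row (scaleR_mat r A) = dim_row A" "dim_col (scaleR_mat r A) = dim_col A"
  by (simp_all add: scaleR_mat_def)

lemma one_op_mat_carrier [simp]: "one_op_mat n \<in> carrier_mat n n"
  by (simp add: one_op_mat_def)

lemma one_op_mat_index [simp]:
  "i < n \<Longrightarrow> j < n \<Longrightarrow> one_op_mat n $$ (i, j) = (if i = j then id_blinfun else 0)"
  "dim_row (one_op_mat n) = n" "dim_col (one_op_mat n) = n"
  by (simp_all add: one_op_mat_def)

lemma mat_form_scaleR_mat: "mat_form (scaleR_mat r A) \<xi> \<eta> = of_real r * mat_form A \<xi> \<eta>"
proof -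
  have "A \<in> carrier_mat (dim_row A) (dim_col A)" by auto
  then show ?thesis
    using mat_form_sum[of A "dim_row A" "dim_col A"]
      mat_form_sum[of "scaleR_mat r A" "dim_row A" "dim_col A"]
    by (simp add: blinfun.scaleR_left cinner_scaleR_right sum_distrib_left)
qed

lemma mat_form_one: "mat_form (one_op_mat n) \<xi> \<xi> = of_real ((hnorm n \<xi>)\<^sup>2)"
proof -
  have "mat_apply (one_op_mat n) \<xi> i = \<xi> i" if "i < n" for i
  proof -
    have "mat_apply (one_op_mat n) \<xi> i = (\<Sum>j<n. if i = j then \<xi> j else 0)"
      unfolding mat_apply_def using that by (intro sum.cong) auto
    then show ?thesis
      using that by simp
  qed
  then show ?thesis
    by (simp add: mat_form_def cinner_self hnorm_squared)
qed

lemma mat_form_scaleR_args: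
  "mat_form A (\<lambda>i. s *\<^sub>R \<xi> i) (\<lambda>j. t *\<^sub>R \<eta> j) = of_real (s * t) * mat_form A \<xi> \<eta>"
proof -
  have "mat_apply A (\<lambda>j. t *\<^sub>R \<eta> j) i = t *\<^sub>R mat_apply A \<eta> i" for i
    by (simp add: mat_apply_def blinfun.scaleR_right scaleR_right.sum)
  then show ?thesis
    by (simp add: mat_form_def cinner_scaleR_right cinner_scaleR_left sum_distrib_left mult_ac)
qed

lemma mat_form_scaleC_left: "mat_form A (\<lambda>i. a *\<^sub>C \<xi> i) \<eta> = cnj a * mat_form A \<xi> \<eta>"
  by (simp add: mat_form_def cinner_scaleC_left sum_distrib_left)

lemma mat_form_scaleC_right:
  assumes "A \<in> carrier_mat n m" "\<And>i j. i < n \<Longrightarrow> j < m \<Longrightarrow> clinear_op (A $$ (i, j))"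
  shows "mat_form A \<xi> (\<lambda>j. a *\<^sub>C \<eta> j) = a * mat_form A \<xi> \<eta>"
  using assms unfolding mat_form_sum[OF assms(1)] sum_distrib_left
  by (intro sum.cong) (simp_all add: clinear_op_def cinner_scaleC_right)

lemma mat_norm_ratio_le:
  "hnorm (dim_row A) (mat_apply A \<xi>) / hnorm (dim_col A) \<xi> \<le> mat_norm A"
  unfolding mat_norm_def by (rule cSUP_upper[OF UNIV_I bdd_above_mat_norm])

lemma mat_norm_nonneg: "0 \<le> mat_norm A"
  using mat_norm_ratio_le[of A undefined] by (rule order.trans[rotated]) (simp add: L2_set_nonneg)

lemma mat_apply_norm_le: "hnorm (dim_row A) (mat_apply A \<xi>) \<le> mat_norm A * hnorm (dim_col A) \<xi>"
proof (cases "hnorm (dim_col A) \<xi> = 0")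
  case True
  then have "mat_apply A \<xi> i = 0" for i
    by (simp add: L2_set_eq_0_iff mat_apply_def blinfun.zero_right)
  then show ?thesis
    using True by (simp add: L2_set_def)
next
  case False
  then have "0 < hnorm (dim_col A) \<xi>"
    using L2_set_nonneg[of "\<lambda>i. norm (\<xi> i)" "{..<dim_col A}"] by linarith
  then show ?thesis
    using mat_norm_ratio_le[of A \<xi>] by (simp add: pos_divide_le_eq)
qed

text \<open>Bounding only the real part suffices, since the forms of interest are real, and reduces the
  estimate to the Cauchy-Schwarz inequality for the real inner product.\<close>

lemma abs_Re_mat_form_le:
  assumes "A \<in> carrier_mat n m"
  shows "\<bar>Re (mat_form A \<xi> \<eta>)\<bar> \<le> mat_norm A * hnorm n \<xi> * hnorm m \<eta>"
proof -
  have "\<bar>Re (mat_form A \<xi> \<eta>)\<bar> = \<bar>\<Sum>i<n. inner (\<xi> i) (mat_apply A \<eta> i)\<bar>"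
    using assms by (simp add: mat_form_def inner_eq_Re_cinner)
  also have "\<dots> \<le> (\<Sum>i<n. \<bar>norm (\<xi> i)\<bar> * \<bar>norm (mat_apply A \<eta> i)\<bar>)"
    by (rule order.trans[OF sum_abs]) (intro sum_mono, simp add: Cauchy_Schwarz_ineq2)
  also have "\<dots> \<le> hnorm n \<xi> * hnorm n (mat_apply A \<eta>)"
    by (rule L2_set_mult_ineq)
  also have "\<dots> \<le> hnorm n \<xi> * (mat_norm A * hnorm m \<eta>)"
    using mat_apply_norm_le[of A \<eta>] assms by (intro mult_left_mono L2_set_nonneg) auto
  finally show ?thesis
    by (simp add: mult_ac)
qed


section \<open>Positive block matrices\<close>

text \<open>The identification \<open>H\<^sup>n \<oplus> H\<^sup>n = H\<^sup>2\<^sup>n\<close>.\<close>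

definition vconcat :: "nat \<Rightarrow> (nat \<Rightarrow> 'a) \<Rightarrow> (nat \<Rightarrow> 'a) \<Rightarrow> nat \<Rightarrow> 'a" where
  "vconcat n \<xi> \<eta> i = (if i < n then \<xi> i else \<eta> (i - n))"

lemma sum_lessThan_add: "(\<Sum>i<n + m. f i) = (\<Sum>i<n. f i) + (\<Sum>i<m. f (n + i :: nat) :: 'b::comm_monoid_add)"
  by (induction m) (simp_all add: add.assoc)

lemma mat_form_four_block:
  assumes "P \<in> carrier_mat n n" "B \<in> carrier_mat n n" "C \<in> carrier_mat n n" "Q \<in> carrier_mat n n"
  shows "mat_form (four_block_mat P B C Q) (vconcat n \<xi> \<eta>) (vconcat n \<xi> \<eta>)
    = mat_form P \<xi> \<xi> + mat_form B \<xi> \<eta> + mat_form C \<eta> \<xi> + mat_form Q \<eta> \<eta>"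
proof -
  have "four_block_mat P B C Q \<in> carrier_mat (n + n) (n + n)"
    using assms by simp
  from mat_form_sum[OF this] show ?thesis
    using assms
    by (simp add: mat_form_sum[where n = n and m = n] sum_lessThan_add vconcat_def sum.distrib add.assoc)
qed

lemma vconcat_split: "\<zeta> = vconcat n \<zeta> (\<lambda>i. \<zeta> (n + i))"
  by (auto simp: vconcat_def)

text \<open>The test vectors are all of the form \<open>(s\<xi>, t\<eta>)\<close> with real \<open>s\<close>, \<open>t\<close>; the choices \<open>(1, 0)\<close> and \<open>(0, 1)\<close>
  recover the corners.\<close>

lemma four_block_pos_quadratic:
  assumes "P \<in> carrier_mat n n" "B \<in> carrier_mat n n" "C \<in> carrier_mat n n" "Q \<in> carrier_mat n n"
    and "mat_pos (four_block_mat P B C Q)"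
  defines "E \<equiv> \<lambda>\<xi> \<eta> s t. of_real (s * s) * mat_form P \<xi> \<xi>
      + of_real (s * t) * (mat_form B \<xi> \<eta> + mat_form C \<eta> \<xi>) + of_real (t * t) * mat_form Q \<eta> \<eta>"
  shows "0 \<le> Re (E \<xi> \<eta> s t)" "Im (E \<xi> \<eta> s t) = 0"
proof -
  have "E \<xi> \<eta> s t = mat_form (four_block_mat P B C Q)
      (vconcat n (\<lambda>i. s *\<^sub>R \<xi> i) (\<lambda>i. t *\<^sub>R \<eta> i)) (vconcat n (\<lambda>i. s *\<^sub>R \<xi> i) (\<lambda>i. t *\<^sub>R \<eta> i))"
    unfolding E_def mat_form_four_block[OF assms(1-4)] mat_form_scaleR_args
    by (simp add: algebra_simps)
  then show "0 \<le> Re (E \<xi> \<eta> s t)" "Im (E \<xi> \<eta> s t) = 0"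
    using assms(5) unfolding mat_pos_iff_form by auto
qed

lemma four_block_pos_corners:
  assumes "P \<in> carrier_mat n n" "B \<in> carrier_mat n n" "C \<in> carrier_mat n n" "Q \<in> carrier_mat n n"
    and "mat_pos (four_block_mat P B C Q)"
  shows "mat_pos P" "mat_pos Q"
  unfolding mat_pos_iff_form
  using four_block_pos_quadratic[OF assms, where s = 1 and t = 0]
    four_block_pos_quadratic[OF assms, where s = 0 and t = 1]
  by simp_all

text \<open>Evaluate the positive quadratic form at \<open>(-\<parallel>\<eta>\<parallel>B\<eta>, \<parallel>B\<eta>\<parallel>\<eta>)\<close>: the diagonal contributes at most
  \<open>2m\<parallel>\<eta>\<parallel>\<^sup>2\<parallel>B\<eta>\<parallel>\<^sup>2\<close> and the blocks \<open>B\<close>, \<open>C\<close> contribute \<open>-2\<parallel>\<eta>\<parallel>\<parallel>B\<eta>\<parallel>\<^sup>3\<close>.  Comparing the two gives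
  \<open>\<parallel>B\<eta>\<parallel> \<le> m\<parallel>\<eta>\<parallel>\<close>.\<close>

lemma mat_norm_off_diagonal_le:
  assumes carrier: "P \<in> carrier_mat n n" "B \<in> carrier_mat n n" "C \<in> carrier_mat n n" "Q \<in> carrier_mat n n"
    and clinear: "\<And>i j. i < n \<Longrightarrow> j < n \<Longrightarrow> clinear_op (C $$ (i, j))"
    and pos: "mat_pos (four_block_mat P B C Q)"
    and P_le: "\<And>\<xi>. Re (mat_form P \<xi> \<xi>) \<le> m * (hnorm n \<xi>)\<^sup>2"
    and Q_le: "\<And>\<xi>. Re (mat_form Q \<xi> \<xi>) \<le> m * (hnorm n \<xi>)\<^sup>2"
    and "0 \<le> m"
  shows "mat_norm B \<le> m"
  unfolding mat_norm_def
proof (rule cSUP_least)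
  fix \<eta> :: "nat \<Rightarrow> 'a"
  define \<xi> where "\<xi> = mat_apply B \<eta>"
  define N where "N = hnorm n \<xi>"
  define M where "M = hnorm n \<eta>"
  have nonneg: "0 \<le> N" "0 \<le> M"
    by (simp_all add: N_def M_def L2_set_nonneg)
  note quad = four_block_pos_quadratic[OF carrier pos]
  have B: "mat_form B \<xi> \<eta> = of_real (N\<^sup>2)"
    using carrier(2) unfolding mat_form_def \<xi>_def[symmetric] N_def hnorm_squared
    by (simp add: cinner_self)
  \<comment> \<open>Positivity forces \<open>C\<close> to contribute as much as \<open>B\<close>: the quadratic form stays real when \<open>\<xi>\<close> is
    multiplied by \<open>\<i>\<close>, which compares the real parts of the two off-diagonal terms.\<close>
  have C: "Re (mat_form C \<eta> \<xi>) = N\<^sup>2"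
  proof -
    let ?\<xi> = "\<lambda>i. \<i> *\<^sub>C \<xi> i"
    have "mat_form B ?\<xi> \<eta> = - \<i> * of_real (N\<^sup>2)" "mat_form C \<eta> ?\<xi> = \<i> * mat_form C \<eta> \<xi>"
      by (simp_all add: mat_form_scaleC_left B mat_form_scaleC_right[OF carrier(3) clinear])
    then show ?thesis
      using quad(2)[where \<xi> = ?\<xi> and \<eta> = \<eta> and s = 1 and t = 1]
        quad(2)[where \<xi> = ?\<xi> and \<eta> = \<eta> and s = 1 and t = 0]
        quad(2)[where \<xi> = ?\<xi> and \<eta> = \<eta> and s = 0 and t = 1]
      by simp
  qed
  have "0 \<le> (M * M) * Re (mat_form P \<xi> \<xi>) - (M * N) * (N\<^sup>2 + N\<^sup>2) + (N * N) * Re (mat_form Q \<eta> \<eta>)"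
    using quad(1)[where \<xi> = \<xi> and \<eta> = \<eta> and s = "- M" and t = N] by (simp add: B C)
  also have "\<dots> \<le> (M * M) * (m * N\<^sup>2) - (M * N) * (N\<^sup>2 + N\<^sup>2) + (N * N) * (m * M\<^sup>2)"
    using P_le[of \<xi>] Q_le[of \<eta>] unfolding N_def[symmetric] M_def[symmetric]
    by (intro add_mono diff_mono mult_left_mono) (auto simp: nonneg)
  also have "\<dots> = 2 * (M * N\<^sup>2) * (m * M - N)"
    by (simp add: power2_eq_square algebra_simps)
  finally have *: "0 \<le> 2 * (M * N\<^sup>2) * (m * M - N)" .
  \<comment> \<open>For \<open>M = 0\<close> the quotient is \<open>0\<close> by convention, as for \<open>N = 0\<close>, so there only \<open>0 \<le> m\<close> is at stake.\<close>
  have "N / M \<le> m"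
  proof (cases "M = 0 \<or> N = 0")
    case True
    then show ?thesis using \<open>0 \<le> m\<close> by auto
  next
    case False
    then have "0 < M" "0 < 2 * (M * N\<^sup>2)"
      using nonneg by auto
    then show ?thesis
      using * by (simp add: zero_le_mult_iff pos_divide_le_eq)
  qed
  then show "hnorm (dim_row B) (mat_apply B \<eta>) / hnorm (dim_col B) \<eta> \<le> m"
    using carrier by (simp add: N_def M_def \<xi>_def)
qed simp


section \<open>Kernels, cosets and identified kernels\<close>

lemma mats_iff: "A \<in> mats n S \<longleftrightarrow> A \<in> carrier_mat n n \<and> (\<forall>i<n. \<forall>j<n. A $$ (i, j) \<in> S)"
proof -
  have "elements_mat A \<subseteq> S \<longleftrightarrow> (\<forall>i<n. \<forall>j<n. A $$ (i, j) \<in> S)" if "A \<in> carrier_mat n n"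
    using that by (auto dest!: elements_matD)
  then show ?thesis
    by (auto simp: mats_def)
qed

lemma mats_mono: "K \<subseteq> S \<Longrightarrow> A \<in> mats n K \<Longrightarrow> A \<in> mats n S"
  by (auto simp: mats_iff)

lemma mats_add:
  assumes "complex_vector.subspace S" "A \<in> mats n S" "B \<in> mats n S"
  shows "A + B \<in> mats n S"
  using assms by (auto simp: mats_iff intro!: complex_vector.subspace_add)

lemma mats_diff:
  assumes "complex_vector.subspace S" "A \<in> mats n S" "B \<in> mats n S"
  shows "A - B \<in> mats n S"
  using assms by (auto simp: mats_iff intro!: complex_vector.subspace_diff)

lemma mats_scaleR:
  assumes "complex_vector.subspace S" "A \<in> mats n S"
  shows "scaleR_mat r A \<in> mats n S"
  using assms by (auto simp: mats_iff scaleR_scaleC intro!: complex_vector.subspace_scale)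

lemma mats_one:
  assumes "complex_vector.subspace S" "id_blinfun \<in> S"
  shows "one_op_mat n \<in> mats n S"
  using assms by (auto simp: mats_iff intro!: complex_vector.subspace_0)

lemma mats_zero:
  assumes "complex_vector.subspace S"
  shows "0\<^sub>m n n \<in> mats n S"
  using complex_vector.subspace_0[OF assms] by (simp add: mats_iff)

lemma completely_positive_linear:
  assumes "completely_positive S T \<phi>" "complex_vector.subspace S"
  shows "\<phi> 0 = 0"
    and "x \<in> S \<Longrightarrow> y \<in> S \<Longrightarrow> \<phi> (x + y) = \<phi> x + \<phi> y"
    and "x \<in> S \<Longrightarrow> y \<in> S \<Longrightarrow> \<phi> (x - y) = \<phi> x - \<phi> y"
    and "x \<in> S \<Longrightarrow> \<phi> (r *\<^sub>R x) = r *\<^sub>R \<phi> x"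
proof -
  have add: "\<phi> (x + y) = \<phi> x + \<phi> y" if "x \<in> S" "y \<in> S" for x y
    using assms(1) that by (simp add: completely_positive_def)
  have scale: "\<phi> (c *\<^sub>C x) = c *\<^sub>C \<phi> x" if "x \<in> S" for c x
    using assms(1) that by (simp add: completely_positive_def)
  show "\<phi> 0 = 0"
    using scale[of 0 0] complex_vector.subspace_0[OF assms(2)] by simp
  show "x \<in> S \<Longrightarrow> y \<in> S \<Longrightarrow> \<phi> (x + y) = \<phi> x + \<phi> y"
    by (rule add)
  show "x \<in> S \<Longrightarrow> \<phi> (r *\<^sub>R x) = r *\<^sub>R \<phi> x"
    by (simp add: scaleR_scaleC scale)
  show "\<phi> (x - y) = \<phi> x - \<phi> y" if "x \<in> S" "y \<in> S"
    using add[of "x - y" y] complex_vector.subspace_diff[OF assms(2)] that by simp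
qed

lemma subspace_kernel:
  assumes "is_kernel TYPE('c::complex_hilbert_space) S J"
  shows "complex_vector.subspace J" "J \<subseteq> S"
proof -
  obtain T and \<phi> :: "_ \<Rightarrow> ('c \<Rightarrow>\<^sub>L 'c)" where \<phi>: "completely_positive S T \<phi>" and J: "J = {x \<in> S. \<phi> x = 0}"
    and "operator_system S"
    using assms unfolding is_kernel_def by blast
  then have S: "complex_vector.subspace S"
    by (simp add: operator_system_def)
  have "\<phi> (c *\<^sub>C x) = c *\<^sub>C \<phi> x" if "x \<in> S" for c x
    using \<phi> that by (simp add: completely_positive_def)
  then show "complex_vector.subspace J"
    unfolding J using S completely_positive_linear(1,2)[OF \<phi> S]
    by (auto simp: complex_vector.subspace_def)
  show "J \<subseteq> S"
    by (auto simp: J)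
qed

lemma dot_eqD:
  assumes "dot K X = dot K X'" "X \<in> carrier_mat n n" "X' \<in> carrier_mat n n"
    and K: "complex_vector.subspace K"
  obtains Y where "Y \<in> mats n K" "X = X' + Y"
proof
  have "X $$ (i, j) - X' $$ (i, j) \<in> K" if "i < n" "j < n" for i j
  proof -
    have "coset K (X $$ (i, j)) = coset K (X' $$ (i, j))"
      using arg_cong[OF assms(1), of "\<lambda>A. A $$ (i, j)"] assms(2,3) that by (simp add: dot_def)
    moreover have "X $$ (i, j) \<in> coset K (X $$ (i, j))"
      using complex_vector.subspace_0[OF K] by (force simp: coset_def)
    ultimately show ?thesis
      by (auto simp: coset_def)
  qed
  then show "X - X' \<in> mats n K"
    using assms(2,3) by (auto simp: mats_iff)
  show "X = X' + (X - X')"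
    using assms(2,3) by (intro eq_matI) auto
qed

text \<open>The cone of the quotient is defined through representatives.  Changing them only adds matrices over
  \<open>K\<close>, so any given representative \<open>Z\<close> can serve, and all the corrections are absorbed in one \<open>Y\<close>.\<close>

lemma quot_posD:
  assumes "dot K Z \<in> quot_pos n S K" "Z \<in> carrier_mat n n" "0 < \<epsilon>" "complex_vector.subspace K"
  obtains Y where "Y \<in> mats n K" "mat_pos (Z + scaleR_mat \<epsilon> (one_op_mat n) + Y)"
proof -
  let ?E = "scaleR_mat \<epsilon> (one_op_mat n)"
  obtain X where X: "X \<in> mats n S" "dot K X = dot K Z" and "dot K (X + ?E) \<in> quot_D n S K"
    using assms(1,3) unfolding quot_pos_def by force
  then obtain X' Y1 where X': "X' \<in> mats n S" "dot K X' = dot K (X + ?E)"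
    and Y1: "Y1 \<in> mats n K" "mat_pos (X' + Y1)"
    unfolding quot_D_def mats_pos_def by force
  have cX: "X \<in> carrier_mat n n" "X' \<in> carrier_mat n n" "X + ?E \<in> carrier_mat n n"
    using X X' by (auto simp: mats_iff)
  obtain Y2 where Y2: "Y2 \<in> mats n K" "X = Z + Y2"
    using dot_eqD[OF X(2) cX(1) assms(2,4)] .
  obtain Y3 where Y3: "Y3 \<in> mats n K" "X' = X + ?E + Y3"
    using dot_eqD[OF X'(2) cX(2,3) assms(4)] .
  show thesis
  proof
    show "Y1 + Y2 + Y3 \<in> mats n K"
      using Y1 Y2 Y3 by (intro mats_add[OF assms(4)])
    have "X' + Y1 = Z + ?E + (Y1 + Y2 + Y3)"
      unfolding Y3(2) Y2(2) using Y1 Y2 Y3 assms(2) by (intro eq_matI) (auto simp: mats_iff)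
    then show "mat_pos (Z + ?E + (Y1 + Y2 + Y3))"
      using Y1(2) by simp
  qed
qed

lemma subspace_unitization:
  assumes "complex_vector.subspace J"
  shows "complex_vector.subspace (unitization J)" "id_blinfun \<in> unitization J" "J \<subseteq> unitization J"
proof -
  have mem: "c *\<^sub>C id_blinfun + y \<in> unitization J" if "y \<in> J" for c y
    using that by (auto simp: unitization_def)
  show "id_blinfun \<in> unitization J"
    using mem[of 0 1] complex_vector.subspace_0[OF assms] by simp
  show "J \<subseteq> unitization J"
    using mem[of _ 0] by auto
  show "complex_vector.subspace (unitization J)"
    unfolding complex_vector.subspace_def
  proof (intro conjI ballI allI)
    show "0 \<in> unitization J"
      using mem[of 0 0] complex_vector.subspace_0[OF assms] by simp
  next
    fix x y assume "x \<in> unitization J" "y \<in> unitization J"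
    then obtain a b u v where "x = a *\<^sub>C id_blinfun + u" "y = b *\<^sub>C id_blinfun + v" "u \<in> J" "v \<in> J"
      by (auto simp: unitization_def)
    then show "x + y \<in> unitization J"
      using mem[of "u + v" "a + b"] complex_vector.subspace_add[OF assms]
      by (simp add: scaleC_add_left algebra_simps)
  next
    fix c x assume "x \<in> unitization J"
    then obtain a u where "x = a *\<^sub>C id_blinfun + u" "u \<in> J"
      by (auto simp: unitization_def)
    then show "c *\<^sub>C x \<in> unitization J"
      using mem[of "c *\<^sub>C u" "c * a"] complex_vector.subspace_scale[OF assms]
      by (simp add: scaleC_add_right scaleC_scaleC)
  qed
qed

text \<open>A unital complete order isomorphism transports both the positive matrix \<open>1 + Y\<close> and, backwards,
  the inequality \<open>1 + Y' \<le> \<parallel>1 + Y'\<parallel>1\<close>; so upper bounds of \<open>1 + Y\<close> can be read off in \<open>J\<close>.\<close>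

lemma identified_kernel_form_le:
  fixes J :: "('a::complex_hilbert_space \<Rightarrow>\<^sub>L 'a) set" and K :: "('b::complex_hilbert_space \<Rightarrow>\<^sub>L 'b) set"
  assumes "kernels_identified J K" "complex_vector.subspace J" "complex_vector.subspace K"
    and Y: "Y \<in> mats n K" "mat_pos (one_op_mat n + Y)"
  obtains Y' where "Y' \<in> mats n J" "mat_pos (one_op_mat n + Y')"
    "\<And>\<xi>. Re (mat_form (one_op_mat n + Y) \<xi> \<xi>) \<le> mat_norm (one_op_mat n + Y') * (hnorm n \<xi>)\<^sup>2"
proof -
  \<comment> \<open>The matrix \<open>Y'\<close> is the preimage of \<open>Y\<close>, and the bound holds since \<open>r1 - (1 + Y')\<close>, with
    \<open>r = \<parallel>1 + Y'\<parallel>\<close>, is a positive matrix over the unitization of \<open>J\<close>.\<close>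
  obtain \<phi> where iso: "complete_order_iso (unitization J) (unitization K) \<phi>"
    and \<phi>1: "\<phi> id_blinfun = id_blinfun" and \<phi>J: "\<phi> ` J = K"
    using assms(1) unfolding kernels_identified_def by blast
  define \<psi> where "\<psi> = inv_into (unitization J) \<phi>"
  have bij: "bij_betw \<phi> (unitization J) (unitization K)"
    and \<phi>: "completely_positive (unitization J) (unitization K) \<phi>"
    and \<psi>: "completely_positive (unitization K) (unitization J) \<psi>"
    using iso by (simp_all add: complete_order_iso_def \<psi>_def)
  note uJ = subspace_unitization[OF assms(2)] and uK = subspace_unitization[OF assms(3)]
  note \<phi>lin = completely_positive_linear[OF \<phi> uJ(1)] and \<psi>lin = completely_positive_linear[OF \<psi> uK(1)]
  have \<psi>\<phi>: "\<psi> (\<phi> x) = x" if "x \<in> unitization J" for x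
    unfolding \<psi>_def using bij_betw_inv_into_left[OF bij that] .
  have \<phi>\<psi>: "\<phi> (\<psi> y) = y" if "y \<in> unitization K" for y
    unfolding \<psi>_def using bij_betw_inv_into_right[OF bij that] .
  have \<psi>1: "\<psi> id_blinfun = id_blinfun"
    using \<psi>\<phi>[OF uJ(2)] by (simp add: \<phi>1)
  have \<psi>K: "\<psi> y \<in> J" if "y \<in> K" for y
    using that \<psi>\<phi> uJ(3) unfolding \<phi>J[symmetric] by auto
  let ?P = "one_op_mat n + Y"
  define Y' where "Y' = map_mat \<psi> Y"
  let ?P' = "one_op_mat n + Y'"
  define r where "r = mat_norm ?P'"
  have cY: "Y \<in> carrier_mat n n" and cY': "Y' \<in> carrier_mat n n"
    using Y by (auto simp: mats_iff Y'_def)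
  have Y': "Y' \<in> mats n J"
    using Y(1) by (auto simp: mats_iff Y'_def \<psi>K)
  have Puni: "?P \<in> mats n (unitization K)"
    by (intro mats_add[OF uK(1)] mats_one[OF uK(1,2)] mats_mono[OF uK(3) Y(1)])
  have P'uni: "?P' \<in> mats n (unitization J)"
    by (intro mats_add[OF uJ(1)] mats_one[OF uJ(1,2)] mats_mono[OF uJ(3) Y'])
  have map: "map_mat \<psi> ?P = ?P'"
  proof (rule eq_matI)
    fix i j assume "i < dim_row ?P'" "j < dim_col ?P'"
    then have ij: "i < n" "j < n"
      using cY' by auto
    have "Y $$ (i, j) \<in> unitization K" "(if i = j then id_blinfun else 0) \<in> unitization K"
      using Y(1) ij uK complex_vector.subspace_0[OF uK(1)] by (auto simp: mats_iff)
    then show "map_mat \<psi> ?P $$ (i, j) = ?P' $$ (i, j)"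
      using ij cY by (simp add: Y'_def \<psi>lin(1,2) \<psi>1)
  qed (use cY cY' in auto)
  have pos': "mat_pos ?P'"
    using \<psi> Puni Y(2) unfolding map[symmetric] completely_positive_def mats_pos_def by blast
  let ?D = "scaleR_mat r (one_op_mat n) - ?P'"
  have scale: "r *\<^sub>R x \<in> unitization J" if "x \<in> unitization J" for x
    unfolding scaleR_scaleC using uJ(1) that by (rule complex_vector.subspace_scale)
  have "?D \<in> mats n (unitization J)"
    by (intro mats_diff[OF uJ(1)] mats_scaleR[OF uJ(1)] mats_one[OF uJ(1,2)] P'uni)
  moreover have "mat_pos ?D"
    unfolding mat_pos_iff_form
  proof
    fix \<xi> :: "nat \<Rightarrow> 'a"
    have "mat_form ?D \<xi> \<xi> = of_real (r * (hnorm n \<xi>)\<^sup>2) - mat_form ?P' \<xi> \<xi>"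
      using cY' by (simp add: mat_form_diff[where n = n and m = n] mat_form_scaleR_mat mat_form_one)
    moreover have "\<bar>Re (mat_form ?P' \<xi> \<xi>)\<bar> \<le> r * (hnorm n \<xi>)\<^sup>2"
      using abs_Re_mat_form_le[of ?P' n n \<xi> \<xi>] cY' by (simp add: r_def power2_eq_square mult.assoc)
    moreover have "Im (mat_form ?P' \<xi> \<xi>) = 0"
      using pos' by (simp add: mat_pos_iff_form)
    ultimately show "0 \<le> Re (mat_form ?D \<xi> \<xi>) \<and> Im (mat_form ?D \<xi> \<xi>) = 0"
      by simp
  qed
  ultimately have "mat_pos (map_mat \<phi> ?D)"
    using \<phi> unfolding completely_positive_def mats_pos_def by blast
  moreover have "map_mat \<phi> ?D = scaleR_mat r (one_op_mat n) - ?P"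
  proof (rule eq_matI)
    fix i j assume "i < dim_row (scaleR_mat r (one_op_mat n) - ?P)" "j < dim_col (scaleR_mat r (one_op_mat n) - ?P)"
    then have ij: "i < n" "j < n"
      using cY by auto
    let ?d = "if i = j then id_blinfun else 0 :: 'a \<Rightarrow>\<^sub>L 'a"
    have d: "?d \<in> unitization J" and d': "\<phi> ?d = (if i = j then id_blinfun else 0)"
      using uJ complex_vector.subspace_0[OF uJ(1)] by (simp_all add: \<phi>1 \<phi>lin(1))
    have y: "Y $$ (i, j) \<in> unitization K" "\<psi> (Y $$ (i, j)) \<in> unitization J"
      using Y(1) ij uK(3) uJ(3) \<psi>K by (auto simp: mats_iff)
    have "map_mat \<phi> ?D $$ (i, j) = \<phi> (r *\<^sub>R ?d - (?d + \<psi> (Y $$ (i, j))))"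
      using ij cY by (simp add: Y'_def)
    also have "\<dots> = r *\<^sub>R \<phi> ?d - (\<phi> ?d + Y $$ (i, j))"
      using d y scale[OF d] complex_vector.subspace_add[OF uJ(1) d y(2)]
      by (simp only: \<phi>lin(2-4) \<phi>\<psi>)
    also have "\<dots> = (scaleR_mat r (one_op_mat n) - ?P) $$ (i, j)"
      unfolding d' using ij cY by simp
    finally show "map_mat \<phi> ?D $$ (i, j) = (scaleR_mat r (one_op_mat n) - ?P) $$ (i, j)" .
  qed (use cY cY' in auto)
  ultimately have pos: "mat_pos (scaleR_mat r (one_op_mat n) - ?P)"
    by simp
  have "Re (mat_form ?P \<xi> \<xi>) \<le> r * (hnorm n \<xi>)\<^sup>2" for \<xi>
    using pos cY unfolding mat_pos_iff_form
    by (simp add: mat_form_diff[where n = n and m = n] mat_form_scaleR_mat mat_form_one)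
  then show thesis
    using that[OF Y' pos'] by (simp add: r_def)
qed


section \<open>Comparing the quotient norms\<close>

text \<open>Dividing by \<open>r\<close> turns a corner \<open>r1 + A\<close> into a matrix \<open>1 + Y\<close> of the kind over which the theta
  parameter is the supremum.\<close>

lemma theta_form_le:
  fixes J :: "('a::complex_hilbert_space \<Rightarrow>\<^sub>L 'a) set" and K :: "('b::complex_hilbert_space \<Rightarrow>\<^sub>L 'b) set"
  assumes "kernels_identified J K" "complex_vector.subspace J" "complex_vector.subspace K"
    and "theta n J = ennreal t" "0 \<le> t" and "0 < r"
    and A: "A \<in> mats n K" "mat_pos (scaleR_mat r (one_op_mat n) + A)"
  shows "Re (mat_form (scaleR_mat r (one_op_mat n) + A) \<xi> \<xi>) \<le> r * t * (hnorm n \<xi>)\<^sup>2"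
proof -
  define Y where "Y = scaleR_mat (inverse r) A"
  have cA: "A \<in> carrier_mat n n"
    using A by (simp add: mats_iff)
  have eq: "scaleR_mat r (one_op_mat n) + A = scaleR_mat r (one_op_mat n + Y)"
    using cA \<open>0 < r\<close> by (intro eq_matI) (auto simp: Y_def scaleR_add_right)
  have Y: "Y \<in> mats n K"
    unfolding Y_def by (rule mats_scaleR[OF assms(3) A(1)])
  have pos: "mat_pos (one_op_mat n + Y)"
    using A(2) \<open>0 < r\<close> unfolding eq mat_pos_iff_form mat_form_scaleR_mat
    by (simp add: zero_le_mult_iff)
  obtain Y' where Y': "Y' \<in> mats n J" "mat_pos (one_op_mat n + Y')"
    and le: "Re (mat_form (one_op_mat n + Y) \<xi> \<xi>) \<le> mat_norm (one_op_mat n + Y') * (hnorm n \<xi>)\<^sup>2"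
    using identified_kernel_form_le[OF assms(1-3) Y pos] by metis
  have "ennreal (mat_norm (one_op_mat n + Y')) \<le> theta n J"
    unfolding theta_def using Y' by (intro SUP_upper) simp
  then have "mat_norm (one_op_mat n + Y') \<le> t"
    using assms(4,5) by simp
  then have "Re (mat_form (one_op_mat n + Y) \<xi> \<xi>) \<le> t * (hnorm n \<xi>)\<^sup>2"
    using le by (meson mult_right_mono order.trans zero_le_power2)
  then show ?thesis
    using \<open>0 < r\<close> unfolding eq mat_form_scaleR_mat by (simp add: mult.assoc)
qed

lemma mats_four_block_split:
  assumes "Y \<in> mats (2 * n) K"
  obtains A B C D where "A \<in> mats n K" "B \<in> mats n K" "C \<in> mats n K" "D \<in> mats n K"
    "Y = four_block_mat A B C D"
proof
  let ?b = "\<lambda>k l. mat n n (\<lambda>(i, j). Y $$ (k + i, l + j))"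
  show "?b 0 0 \<in> mats n K" "?b 0 n \<in> mats n K" "?b n 0 \<in> mats n K" "?b n n \<in> mats n K"
    using assms by (auto simp: mats_iff)
  show "Y = four_block_mat (?b 0 0) (?b 0 n) (?b n 0) (?b n n)"
    using assms by (intro eq_matI) (auto simp: mats_iff)
qed

lemma osp_norm_le:
  assumes "Y \<in> mats n K"
  shows "osp_norm n K X \<le> mat_norm (X + Y)"
  unfolding osp_norm_def by (rule cInf_lower) (use assms mat_norm_nonneg in \<open>auto intro!: bdd_belowI\<close>)

abbreviation osy_block :: "nat \<Rightarrow> real \<Rightarrow> ('a::complex_hilbert_space \<Rightarrow>\<^sub>L 'a) mat \<Rightarrow> ('a \<Rightarrow>\<^sub>L 'a) mat" where
  "osy_block n r X \<equiv> four_block_mat (scaleR_mat r (one_op_mat n)) X (cadjoint_mat X) (scaleR_mat r (one_op_mat n))"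

lemma osy_block_carrier:
  assumes "X \<in> carrier_mat n n"
  shows "osy_block n r X \<in> carrier_mat (n + n) (n + n)" "cadjoint_mat X \<in> carrier_mat n n"
  using assms by (auto simp: cadjoint_mat_def)

lemma cadjoint_operator_system:
  assumes "operator_system S" "T \<in> S"
  shows "cadjoint T \<in> S" "is_cadjoint T (cadjoint T)"
  using assms cadjoint_eqI unfolding operator_system_def by metis+

lemma cadjoint_mat_mats:
  assumes "operator_system S" "X \<in> mats n S"
  shows "cadjoint_mat X \<in> mats n S"
  using assms by (auto simp: mats_iff cadjoint_mat_def cadjoint_operator_system)

text \<open>The heart of the argument: the \<open>K\<close>-valued correction that makes the block matrix positive contains,
  in its upper right block, a matrix \<open>B\<close> that makes \<open>X + B\<close> small.\<close>

lemma osp_norm_le_theta: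
  fixes J :: "('a::complex_hilbert_space \<Rightarrow>\<^sub>L 'a) set" and K S :: "('b::complex_hilbert_space \<Rightarrow>\<^sub>L 'b) set"
  assumes "kernels_identified J K" "complex_vector.subspace J" "complex_vector.subspace K"
    and "K \<subseteq> S" "operator_system S" "X \<in> mats n S"
    and t: "theta n J = ennreal t" "0 \<le> t" and r: "0 \<le> r" "0 < \<epsilon>"
    and pos: "dot K (osy_block n r X) \<in> quot_pos (2 * n) S K"
  shows "osp_norm n K X \<le> (r + \<epsilon>) * t"
proof -
  have X: "X \<in> carrier_mat n n"
    using assms(6) by (simp add: mats_iff)
  have Z: "osy_block n r X \<in> carrier_mat (2 * n) (2 * n)"
    using osy_block_carrier(1)[OF X] by (simp add: mult_2)
  obtain Y where Y: "Y \<in> mats (2 * n) K"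
    and Ypos: "mat_pos (osy_block n r X + scaleR_mat \<epsilon> (one_op_mat (2 * n)) + Y)"
    using quot_posD[OF pos Z r(2) assms(3)] .
  obtain A B C D where ABCD: "A \<in> mats n K" "B \<in> mats n K" "C \<in> mats n K" "D \<in> mats n K"
    and Y_eq: "Y = four_block_mat A B C D"
    using mats_four_block_split[OF Y] .
  let ?I = "scaleR_mat (r + \<epsilon>) (one_op_mat n)"
  have carrier: "?I + A \<in> carrier_mat n n" "X + B \<in> carrier_mat n n"
    "cadjoint_mat X + C \<in> carrier_mat n n" "?I + D \<in> carrier_mat n n"
    using ABCD by (auto simp: mats_iff)
  have "osy_block n r X + scaleR_mat \<epsilon> (one_op_mat (2 * n)) + Y
      = four_block_mat (?I + A) (X + B) (cadjoint_mat X + C) (?I + D)"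
    unfolding Y_eq using ABCD X osy_block_carrier(2)[OF X]
    by (intro eq_matI) (auto simp: mats_iff scaleR_add_left)
  then have block: "mat_pos (four_block_mat (?I + A) (X + B) (cadjoint_mat X + C) (?I + D))"
    using Ypos by simp
  have clinear: "clinear_op ((cadjoint_mat X + C) $$ (i, j))" if "i < n" "j < n" for i j
  proof -
    have "cadjoint_mat X $$ (i, j) \<in> S" "C $$ (i, j) \<in> S" "C \<in> carrier_mat n n"
      using cadjoint_mat_mats[OF assms(5,6)] ABCD(3) \<open>K \<subseteq> S\<close> that by (auto simp: mats_iff)
    then have "(cadjoint_mat X + C) $$ (i, j) \<in> S"
      using that assms(5) complex_vector.subspace_add by (auto simp: operator_system_def)
    then show ?thesis
      using assms(5) by (simp add: operator_system_def)
  qed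
  have "0 < r + \<epsilon>"
    using r by simp
  note le = theta_form_le[OF assms(1-3) t this]
  have "mat_norm (X + B) \<le> (r + \<epsilon>) * t"
    using mat_norm_off_diagonal_le[OF carrier clinear block] four_block_pos_corners[OF carrier block]
      le[OF ABCD(1)] le[OF ABCD(4)] t(2) r by simp
  then show ?thesis
    using osp_norm_le[OF ABCD(2), of X] by linarith
qed

lemma mat_form_cadjoint_mat:
  assumes "operator_system S" "X \<in> mats n S"
  shows "mat_form (cadjoint_mat X) \<eta> \<xi> = cnj (mat_form X \<xi> \<eta>)"
proof -
  have X: "X \<in> carrier_mat n n"
    using assms(2) by (simp add: mats_iff)
  have adj: "cinner (\<eta> i) (blinfun_apply (cadjoint_mat X $$ (i, j)) (\<xi> j))
      = cnj (cinner (\<xi> j) (blinfun_apply (X $$ (j, i)) (\<eta> i)))" if "i < n" "j < n" for i j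
  proof -
    have "is_cadjoint (X $$ (j, i)) (cadjoint_mat X $$ (i, j))"
      using assms that X by (auto simp: mats_iff cadjoint_mat_def cadjoint_operator_system)
    then show ?thesis
      unfolding is_cadjoint_def by (metis cinner_commute)
  qed
  have "mat_form (cadjoint_mat X) \<eta> \<xi> = (\<Sum>i<n. \<Sum>j<n. cnj (cinner (\<xi> j) (blinfun_apply (X $$ (j, i)) (\<eta> i))))"
    unfolding mat_form_sum[OF osy_block_carrier(2)[OF X]] by (intro sum.cong) (auto simp: adj)
  also have "\<dots> = cnj (mat_form X \<xi> \<eta>)"
    unfolding mat_form_sum[OF X] cnj_sum by (rule sum.swap)
  finally show ?thesis .
qed

lemma osy_block_mat_norm_pos:
  assumes "operator_system S" "X \<in> mats n S"
  shows "mat_pos (osy_block n (mat_norm X) X)"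
  unfolding mat_pos_iff_form
proof
  fix \<zeta> :: "nat \<Rightarrow> 'a"
  define \<eta> where "\<eta> = (\<lambda>i. \<zeta> (n + i))"
  let ?m = "mat_norm X" and ?N = "hnorm n \<zeta>" and ?M = "hnorm n \<eta>"
  have X: "X \<in> carrier_mat n n"
    using assms(2) by (simp add: mats_iff)
  have "mat_form (osy_block n ?m X) \<zeta> \<zeta> = mat_form (osy_block n ?m X) (vconcat n \<zeta> \<eta>) (vconcat n \<zeta> \<eta>)"
    unfolding \<eta>_def vconcat_split[symmetric] ..
  also have "\<dots> = of_real (?m * ?N\<^sup>2 + ?m * ?M\<^sup>2) + (mat_form X \<zeta> \<eta> + cnj (mat_form X \<zeta> \<eta>))"
    using X osy_block_carrier(2)[OF X]
    by (subst mat_form_four_block)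
      (simp_all add: mat_form_scaleR_mat mat_form_one mat_form_cadjoint_mat[OF assms])
  finally have form: "mat_form (osy_block n ?m X) \<zeta> \<zeta> = \<dots>" .
  have "\<bar>Re (mat_form X \<zeta> \<eta>)\<bar> \<le> ?m * ?N * ?M"
    by (rule abs_Re_mat_form_le[OF X])
  moreover have "0 \<le> ?m * (?N - ?M)\<^sup>2"
    by (simp add: mat_norm_nonneg)
  then have "2 * (?m * ?N * ?M) \<le> ?m * ?N\<^sup>2 + ?m * ?M\<^sup>2"
    by (simp add: power2_eq_square algebra_simps)
  ultimately show "0 \<le> Re (mat_form (osy_block n ?m X) \<zeta> \<zeta>) \<and> Im (mat_form (osy_block n ?m X) \<zeta> \<zeta>) = 0"
    unfolding form by simp
qed

text \<open>Without such a witness the system norm would be an infimum over the empty set, which as a real number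
  carries no information.\<close>

lemma osy_block_mat_norm_quot_pos:
  assumes S: "operator_system S" and "X \<in> mats n S" "complex_vector.subspace K"
  shows "dot K (osy_block n (mat_norm X) X) \<in> quot_pos (2 * n) S K"
proof -
  let ?Z = "osy_block n (mat_norm X) X" and ?E = "\<lambda>\<epsilon>. scaleR_mat \<epsilon> (one_op_mat (2 * n))"
  have sub: "complex_vector.subspace S" and id: "id_blinfun \<in> S"
    using S by (auto simp: operator_system_def)
  have one: "scaleR_mat r (one_op_mat k) \<in> mats k S" for r k
    by (intro mats_scaleR[OF sub] mats_one[OF sub id])
  have X: "X \<in> carrier_mat n n"
    using assms(2) by (simp add: mats_iff)
  have Z: "?Z \<in> mats (2 * n) S"
  proof -
    have "?Z $$ (i, j) \<in> S" if "i < n + n" "j < n + n" for i j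
      using one[of "mat_norm X" n] assms(2) cadjoint_mat_mats[OF assms(1,2)] that
      by (simp add: mats_iff del: scaleR_mat_index(1) one_op_mat_index(1))
    then show ?thesis
      using osy_block_carrier(1)[OF X] by (simp add: mats_iff mult_2 del: index_mat_four_block(1))
  qed
  have "dot K (?Z + ?E \<epsilon>) \<in> quot_D (2 * n) S K" if "0 < \<epsilon>" for \<epsilon>
  proof -
    have mem: "?Z + ?E \<epsilon> \<in> mats (2 * n) S"
      by (rule mats_add[OF sub Z one])
    have "?Z \<in> carrier_mat (2 * n) (2 * n)"
      using Z by (simp add: mats_iff)
    then have "mat_pos (?Z + ?E \<epsilon>)"
      using osy_block_mat_norm_pos[OF assms(1,2)] \<open>0 < \<epsilon>\<close> unfolding mat_pos_iff_form
      by (simp add: mat_form_add[where n = "2 * n" and m = "2 * n"] mat_form_scaleR_mat mat_form_one)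
    moreover have "?Z + ?E \<epsilon> + 0\<^sub>m (2 * n) (2 * n) = ?Z + ?E \<epsilon>"
      using mem by (simp add: mats_iff)
    ultimately show ?thesis
      using mem mats_zero[OF assms(3)] unfolding quot_D_def mats_pos_def by (smt (verit) mem_Collect_eq)
  qed
  then show ?thesis
    using Z unfolding quot_pos_def by blast
qed

lemma rel_distortion_le_theta:
  fixes J :: "('a::complex_hilbert_space \<Rightarrow>\<^sub>L 'a) set" and K S :: "('b::complex_hilbert_space \<Rightarrow>\<^sub>L 'b) set"
  assumes "kernels_identified J K" "complex_vector.subspace J"
    and kernel: "is_kernel TYPE('d::complex_hilbert_space) S K"
  shows "rel_distortion n S K \<le> theta n J"
proof (cases "theta n J" rule: ennreal_cases)
  case (real t)
  note K = subspace_kernel[OF kernel]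
  have S: "operator_system S"
    using kernel by (simp add: is_kernel_def)
  show ?thesis
    unfolding rel_distortion_def
  proof (rule SUP_least)
    fix X assume "X \<in> {X \<in> mats n S. dot K X \<noteq> dot K (0\<^sub>m n n)}"
    then have X: "X \<in> mats n S" by simp
    define R where "R = {r. 0 \<le> r \<and> dot K (osy_block n r X) \<in> quot_pos (2 * n) S K}"
    have osy: "osy_norm n S K X = Inf R"
      by (simp add: osy_norm_def R_def)
    have ne: "R \<noteq> {}"
      using osy_block_mat_norm_quot_pos[OF S X K(1)] mat_norm_nonneg by (auto simp: R_def)
    have Inf_nonneg: "0 \<le> Inf R"
      by (rule cInf_greatest[OF ne]) (simp add: R_def)
    have "osp_norm n K X \<le> Inf R * t"
    proof (rule field_le_epsilon)
      fix e :: real assume "0 < e"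
      \<comment> \<open>Both the excess of \<open>r\<close> over the infimum and the Archimedean slack in the cone cost \<open>\<epsilon>t\<close>.\<close>
      define \<epsilon> where "\<epsilon> = e / (2 * (t + 1))"
      have "0 < \<epsilon>"
        using \<open>0 < e\<close> real(1) by (simp add: \<epsilon>_def)
      then obtain r where r: "r \<in> R" "r < Inf R + \<epsilon>"
        using cInf_lessD[OF ne, of "Inf R + \<epsilon>"] by auto
      have "osp_norm n K X \<le> (r + \<epsilon>) * t"
        using osp_norm_le_theta[OF assms(1,2) K S X real(2,1) _ \<open>0 < \<epsilon>\<close>] r(1) by (simp add: R_def)
      also have "\<dots> \<le> (Inf R + 2 * \<epsilon>) * t"
        using r(2) real(1) by (intro mult_right_mono) auto
      also have "\<dots> \<le> Inf R * t + e"
        using \<open>0 < e\<close> real(1) by (simp add: \<epsilon>_def field_simps)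
      finally show "osp_norm n K X \<le> Inf R * t + e" .
    qed
    then have le: "ennreal (osp_norm n K X) \<le> ennreal (Inf R) * theta n J"
      unfolding real(2) using Inf_nonneg real(1) by (simp add: ennreal_mult[symmetric] ennreal_leI)
    show "ennreal (osp_norm n K X) / ennreal (osy_norm n S K X) \<le> theta n J"
    proof (cases "Inf R = 0")
      \<comment> \<open>A vanishing system norm forces a vanishing space norm, and \<open>0 / 0 = 0\<close>.\<close>
      case True
      then show ?thesis using le by (simp add: osy)
    next
      case False
      then show ?thesis
        using le Inf_nonneg unfolding osy by (intro divide_le_posI_ennreal) auto
    qed
  qed
qed simp

lemma distortion_le_theta:
  fixes S J :: "('a::complex_hilbert_space \<Rightarrow>\<^sub>L 'a) set"
  assumes "is_kernel TYPE('c::complex_hilbert_space) S J"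
  shows "distortion TYPE('b::complex_hilbert_space) TYPE('d::complex_hilbert_space) n J \<le> theta n J"
  unfolding distortion_def
  using rel_distortion_le_theta[OF _ subspace_kernel(1)[OF assms], where 'd = 'd]
  by (auto intro!: SUP_least)

theorem theorem4p4:
  fixes S J :: "('a::complex_hilbert_space \<Rightarrow>\<^sub>L 'a) set"
  assumes "is_kernel TYPE('c::complex_hilbert_space) S J"
  shows "distortion TYPE('b::complex_hilbert_space) TYPE('d::complex_hilbert_space) 1 J \<le> theta 1 J
       \<and> distortion_cb TYPE('b) TYPE('d) J \<le> theta_cb J"
  unfolding distortion_cb_def theta_cb_def
  using distortion_le_theta[OF assms, where 'b = 'b and 'd = 'd] by (auto intro!: SUP_mono)

end
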